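(* Let $(X,\tau)$ be a real locally convex space and $K$ a sequentially complete closed normal cone in $X$. Then each component of $K$ is a complete metric space with respect to the Thompson metric $d$.
   Context: A cone $K$ in a real vector space $X$ is a nonempty subset with $K+K\subset K$, $tK\subset K$ for all $t\ge 0$, and $K\cap(-K)=\{0\}$; it induces the order $x\le y\iff y-x\in K$. Two elements $x,y\in K$ are linked ($x\sim y$) if there are $\lambda,\mu>0$ with $x\le\lambda y$ and $y\le\mu x$; this is an equivalence relation on $K$ whose classes are called components. The Thompson metric is $d(x,y)=\inf\{s\ge 0: e^{-s}x\le y\le e^{s}x\}$ for $x,y\in K$, with $\inf\emptyset=\infty$. A subset $A$ of $X$ is order-convex if $\{z: x\le z\le y\}\subset A$ for all $x,y\in A$. A cone $K$ in a topological vector space is normal if $0$ has a neighborhood basis consisting of order-convex sets. $K$ is sequentially complete if every $\tau$-Cauchy sequence in $K$ is $\tau$-convergent to an element of $K$. *)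

theory Defs
  imports "HOL-Analysis.Analysis"
begin

(* A class axiom cannot mention continuous_on or convex at the type being classified, so both
   axioms are spelled out; the lemmas below give their library forms. *)
class real_tvs = real_vector + topological_ab_group_add +
  assumes tendsto_scaleR_Pair:
    "LIM p (nhds (t :: real) \<times>\<^sub>F nhds a). fst p *\<^sub>R snd p :> nhds (t *\<^sub>R a)"

(* Hausdorffness is not part of the definition. *)
class locally_convex_space = real_tvs +
  assumes convex_neighbourhood:
    "open W \<Longrightarrow> 0 \<in> W \<Longrightarrow>
     \<exists>U V. open U \<and> (\<forall>x\<in>V. \<forall>y\<in>V. \<forall>u\<ge>0. \<forall>v\<ge>0. u + v = 1 \<longrightarrow> u *\<^sub>R x + v *\<^sub>R y \<in> V) \<and>
           0 \<in> U \<and> U \<subseteq> V \<and> V \<subseteq> W"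

lemma continuous_on_scaleR_prod:
  "continuous_on UNIV (\<lambda>(t, x :: 'a::real_tvs). t *\<^sub>R x)"
proof (clarsimp simp: continuous_on_def case_prod_beta)
  fix t :: real and a :: 'a
  have "((\<lambda>p. fst p *\<^sub>R snd p) \<longlongrightarrow> t *\<^sub>R a) (nhds (t, a))"
    using tendsto_scaleR_Pair by (simp add: nhds_prod)
  then show "((\<lambda>p. fst p *\<^sub>R snd p) \<longlongrightarrow> t *\<^sub>R a) (at (t, a))"
    by (rule filterlim_mono) (simp_all add: at_within_def)
qed

lemma neighbourhood_base_at_convex:
  "neighbourhood_base_at (0 :: 'a::locally_convex_space) convex euclidean"
  unfolding neighbourhood_base_at_def convex_def open_openin[symmetric]
  using convex_neighbourhood[where ?'a = 'a] by meson

instance real_normed_vector \<subseteq> locally_convex_space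
proof
  show "LIM p (nhds t \<times>\<^sub>F nhds a). fst p *\<^sub>R snd p :> nhds (t *\<^sub>R a)" for t and a :: 'a
    using isCont_scaleR[OF isCont_fst[OF continuous_ident] isCont_snd[OF continuous_ident], of "(t, a)"]
    by (simp add: isCont_def tendsto_at_iff_tendsto_nhds[of "\<lambda>p. fst p *\<^sub>R snd p" "(t, a)", simplified] nhds_prod)
  show "\<exists>U V. open U \<and> (\<forall>x\<in>V. \<forall>y\<in>V. \<forall>u\<ge>0. \<forall>v\<ge>0. u + v = 1 \<longrightarrow> u *\<^sub>R x + v *\<^sub>R y \<in> V) \<and>
      0 \<in> U \<and> U \<subseteq> V \<and> V \<subseteq> W"
    if W: "open W" "0 \<in> W" for W :: "'a set"
  proof -
    obtain e where "e > 0" "ball 0 e \<subseteq> W"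
      using W by (auto simp: open_contains_ball)
    then show ?thesis
      using convex_ball[of "0 :: 'a" e, unfolded convex_def]
      by (intro exI[of _ "ball 0 e"] conjI open_ball subset_refl)
        (simp_all only: centre_in_ball)
  qed
qed

(* Unlike the library constant cone, an ordering cone is nonempty, convex and pointed. *)
definition ordering_cone :: "'a::real_vector set \<Rightarrow> bool" where
  "ordering_cone K \<longleftrightarrow>
     K \<noteq> {} \<and>
     (\<forall>x\<in>K. \<forall>y\<in>K. x + y \<in> K) \<and>
     (\<forall>t\<ge>0. \<forall>x\<in>K. t *\<^sub>R x \<in> K) \<and>
     K \<inter> uminus ` K = {0}"

definition cone_le :: "'a::real_vector set \<Rightarrow> 'a \<Rightarrow> 'a \<Rightarrow> bool" where
  "cone_le K x y \<longleftrightarrow> y - x \<in> K"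

definition linked :: "'a::real_vector set \<Rightarrow> ('a \<times> 'a) set" where
  "linked K = {(x, y). x \<in> K \<and> y \<in> K \<and>
     (\<exists>l>0. \<exists>m>0. cone_le K x (l *\<^sub>R y) \<and> cone_le K y (m *\<^sub>R x))}"

definition components_of_cone :: "'a::real_vector set \<Rightarrow> 'a set set" where
  "components_of_cone K = K // linked K"

lemma equiv_linked:
  assumes "ordering_cone K"
  shows "equiv K (linked K)"
proof (rule equivI)
  show "linked K \<subseteq> K \<times> K"
    by (auto simp: linked_def)
  have "0 \<in> K"
    using assms by (auto simp: ordering_cone_def)
  then show "refl_on K (linked K)"
    by (auto simp: refl_on_def linked_def cone_le_def intro!: exI[of _ "1::real"])
  show "sym (linked K)"
    by (auto simp: sym_def linked_def)
  have le_trans: "\<exists>c>0. cone_le K x (c *\<^sub>R z)"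
    if "a > 0" "b > 0" "cone_le K x (a *\<^sub>R y)" "cone_le K y (b *\<^sub>R z)"
    for a b :: real and x y z
  proof (intro exI conjI)
    have "(a *\<^sub>R y - x) + a *\<^sub>R (b *\<^sub>R z - y) \<in> K"
      using assms that by (auto simp: ordering_cone_def cone_le_def)
    then show "cone_le K x ((a * b) *\<^sub>R z)"
      by (simp add: cone_le_def algebra_simps)
    show "a * b > 0" using that by simp
  qed
  show "trans (linked K)"
  proof (rule transI)
    fix x y z assume xy: "(x, y) \<in> linked K" and yz: "(y, z) \<in> linked K"
    obtain a b where ab: "a > 0" "b > 0" "cone_le K x (a *\<^sub>R y)" "cone_le K y (b *\<^sub>R x)"
      using xy by (auto simp: linked_def)
    obtain c d where cd: "c > 0" "d > 0" "cone_le K y (c *\<^sub>R z)" "cone_le K z (d *\<^sub>R y)"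
      using yz by (auto simp: linked_def)
    have "x \<in> K" "z \<in> K"
      using xy yz by (simp_all add: linked_def)
    then show "(x, z) \<in> linked K"
      using le_trans[OF ab(1) cd(1) ab(3) cd(3)] le_trans[OF cd(2) ab(2) cd(4) ab(4)]
      unfolding linked_def by blast
  qed
qed

(* Extended-real valued: the infimum of the empty set is \<infinity>. *)
definition thompson :: "'a::real_vector set \<Rightarrow> 'a \<Rightarrow> 'a \<Rightarrow> ereal" where
  "thompson K x y = Inf {ereal s | s. 0 \<le> s \<and>
     cone_le K (exp (- s) *\<^sub>R x) y \<and> cone_le K y (exp s *\<^sub>R x)}"

definition order_convex :: "'a::real_vector set \<Rightarrow> 'a set \<Rightarrow> bool" where
  "order_convex K A \<longleftrightarrow> (\<forall>x\<in>A. \<forall>y\<in>A. {z. cone_le K x z \<and> cone_le K z y} \<subseteq> A)"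

definition normal_cone :: "'a::real_tvs set \<Rightarrow> bool" where
  "normal_cone K \<longleftrightarrow> neighbourhood_base_at 0 (order_convex K) euclidean"

(* The Cauchy property for the uniformity of the additive group; the library's Cauchy
   needs a metric. *)
definition tvs_Cauchy :: "(nat \<Rightarrow> 'a::real_tvs) \<Rightarrow> bool" where
  "tvs_Cauchy u \<longleftrightarrow>
     (\<forall>U. open U \<and> 0 \<in> U \<longrightarrow> (\<exists>N. \<forall>m\<ge>N. \<forall>n\<ge>N. u m - u n \<in> U))"

definition sequentially_complete :: "'a::real_tvs set \<Rightarrow> bool" where
  "sequentially_complete K \<longleftrightarrow>
     (\<forall>u. range u \<subseteq> K \<and> tvs_Cauchy u \<longrightarrow> (\<exists>x\<in>K. u \<longlonglongrightarrow> x))"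

end

theory Submission
  imports Defs
begin

text \<open>
  Closedness of the cone makes the infimum defining the Thompson metric attained, so
  \<open>d x y \<le> s\<close> means exactly \<open>exp (- s) x \<le> y \<le> exp s x\<close>; the metric axioms then reduce to
  order manipulations. A \<open>d\<close>-Cauchy sequence is eventually dominated by a single \<open>b \<in> K\<close>,
  whence \<open>- (exp \<epsilon> - 1) b \<le> x\<^sub>m - x\<^sub>n \<le> (exp \<epsilon> - 1) b\<close> for large indices, and normality turns
  this into the Cauchy property for the topology. The topological limit is the \<open>d\<close>-limit
  because the order bounds are closed conditions.
\<close>

text \<open>The condition under the infimum in \<open>thompson\<close>, kept apart from
  \<open>0 \<le> s\<close> so that it can be composed and passed to limits in real arithmetic, away
  from \<open>ereal\<close>.\<close>

definition exp_close :: "'a::real_vector set \<Rightarrow> real \<Rightarrow> 'a \<Rightarrow> 'a \<Rightarrow> bool" where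
  "exp_close K s x y \<longleftrightarrow> cone_le K (exp (- s) *\<^sub>R x) y \<and> cone_le K y (exp s *\<^sub>R x)"

lemma thompson_eq_Inf: "thompson K x y = Inf (ereal ` {s. 0 \<le> s \<and> exp_close K s x y})"
  by (auto simp: thompson_def exp_close_def intro!: arg_cong[where f = Inf])

lemma tendsto_scaleR_tvs:
  fixes a :: "'a::real_tvs"
  assumes "(f \<longlongrightarrow> t) F" "(g \<longlongrightarrow> a) F"
  shows "((\<lambda>x. f x *\<^sub>R g x) \<longlongrightarrow> t *\<^sub>R a) F"
  using filterlim_compose[OF tendsto_scaleR_Pair filterlim_Pair[OF assms]] by simp

section \<open>Order calculus in a cone: the multiplicative form of the metric axioms\<close>

context
  fixes K :: "'a::real_vector set"
  assumes cone: "ordering_cone K"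
begin

lemma cone_add: "x \<in> K \<Longrightarrow> y \<in> K \<Longrightarrow> x + y \<in> K"
  and cone_scaleR: "t \<ge> 0 \<Longrightarrow> x \<in> K \<Longrightarrow> t *\<^sub>R x \<in> K"
  and cone_zero: "0 \<in> K"
  using cone by (auto simp: ordering_cone_def)

lemma cone_le_refl: "cone_le K x x"
  by (simp add: cone_le_def cone_zero)

lemma cone_le_trans: "cone_le K x y \<Longrightarrow> cone_le K y z \<Longrightarrow> cone_le K x z"
  using cone_add[of "y - x" "z - y"] by (simp add: cone_le_def)

lemma cone_le_antisym:
  assumes "cone_le K x y" "cone_le K y x"
  shows "x = y"
proof -
  have "y - x \<in> K \<inter> uminus ` K"
    using assms by (auto simp: cone_le_def image_iff intro!: bexI[of _ "x - y"])
  then have "y - x = 0"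
    using cone unfolding ordering_cone_def by blast
  then show ?thesis
    by simp
qed

lemma cone_le_scaleR: "t \<ge> 0 \<Longrightarrow> cone_le K x y \<Longrightarrow> cone_le K (t *\<^sub>R x) (t *\<^sub>R y)"
  using cone_scaleR[of t "y - x"] by (simp add: cone_le_def scaleR_right_diff_distrib)

lemma cone_le_scaleR_mono: "x \<in> K \<Longrightarrow> s \<le> t \<Longrightarrow> cone_le K (s *\<^sub>R x) (t *\<^sub>R x)"
  using cone_scaleR[of "t - s" x] by (simp add: cone_le_def scaleR_left_diff_distrib)

text \<open>Scaling by \<open>exp s\<close> is undone by scaling by \<open>exp (- s)\<close>. Hence
  the lower bound in \<open>exp_close\<close> becomes an upper bound and the relation becomes
  visibly symmetric.\<close>

lemma cone_le_exp_swap: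
  "cone_le K (exp (- s) *\<^sub>R x) y \<longleftrightarrow> cone_le K x (exp s *\<^sub>R y)"
  using cone_le_scaleR[of "exp s" "exp (- s) *\<^sub>R x" y]
    cone_le_scaleR[of "exp (- s)" x "exp s *\<^sub>R y"]
  by (auto simp: exp_minus)

lemma exp_close_iff: "exp_close K s x y \<longleftrightarrow> cone_le K x (exp s *\<^sub>R y) \<and> cone_le K y (exp s *\<^sub>R x)"
  by (simp add: exp_close_def cone_le_exp_swap)

lemma exp_close_sym: "exp_close K s x y \<longleftrightarrow> exp_close K s y x"
  by (auto simp: exp_close_iff)

lemma exp_close_mono: "x \<in> K \<Longrightarrow> y \<in> K \<Longrightarrow> s \<le> t \<Longrightarrow> exp_close K s x y \<Longrightarrow> exp_close K t x y"
  unfolding exp_close_iff by (meson cone_le_scaleR_mono cone_le_trans exp_le_cancel_iff)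

text \<open>Both factors are 1, so antisymmetry decides; this is where pointedness of the cone
  yields separation of points.\<close>

lemma exp_close_0_iff: "exp_close K 0 x y \<longleftrightarrow> x = y"
  by (auto simp: exp_close_iff cone_le_refl intro: cone_le_antisym)

text \<open>The triangle inequality before infima are taken: the factors \<open>exp s\<close> and
  \<open>exp t\<close> multiply.\<close>

lemma exp_close_trans:
  assumes "exp_close K s x y" "exp_close K t y z"
  shows "exp_close K (s + t) x z"
proof -
  have "cone_le K u (exp (a + b) *\<^sub>R w)"
    if "cone_le K u (exp a *\<^sub>R v)" "cone_le K v (exp b *\<^sub>R w)" for a b u v w
    using cone_le_trans[OF that(1) cone_le_scaleR[OF _ that(2)]] by (simp add: exp_add)
  from this[of x s y t z] this[of z t y s x] show ?thesis
    using assms by (simp add: exp_close_iff add.commute)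
qed

lemma linked_iff_exp_close:
  "(x, y) \<in> linked K \<longleftrightarrow> x \<in> K \<and> y \<in> K \<and> (\<exists>s\<ge>0. exp_close K s x y)"
proof
  assume "(x, y) \<in> linked K"
  then obtain l m where K: "x \<in> K" "y \<in> K" and lm: "l > 0" "m > 0"
    and le: "cone_le K x (l *\<^sub>R y)" "cone_le K y (m *\<^sub>R x)"
    by (auto simp: linked_def)
  \<comment> \<open>One exponent serves both linking constants; the 0 secures
    \<open>s \<ge> 0\<close>.\<close>
  define s where "s = max 0 (max (ln l) (ln m))"
  have "l \<le> exp s" "m \<le> exp s"
    using lm exp_le_cancel_iff[of "ln l" s] exp_le_cancel_iff[of "ln m" s] by (simp_all add: s_def)
  then have "exp_close K s x y"
    using K le cone_le_trans cone_le_scaleR_mono unfolding exp_close_iff by meson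
  moreover have "s \<ge> 0"
    by (simp add: s_def)
  ultimately show "x \<in> K \<and> y \<in> K \<and> (\<exists>s\<ge>0. exp_close K s x y)"
    using K by blast
next
  assume "x \<in> K \<and> y \<in> K \<and> (\<exists>s\<ge>0. exp_close K s x y)"
  then show "(x, y) \<in> linked K"
    unfolding linked_def exp_close_iff using exp_gt_zero by blast
qed

lemma thompson_finite:
  assumes "(x, y) \<in> linked K"
  shows "thompson K x y \<noteq> \<infinity>" "0 \<le> thompson K x y"
proof -
  obtain s where "0 \<le> s" "exp_close K s x y"
    using assms by (auto simp: linked_iff_exp_close)
  then have "thompson K x y \<le> ereal s"
    unfolding thompson_eq_Inf by (intro Inf_lower) auto
  then show "thompson K x y \<noteq> \<infinity>"
    by auto
  show "0 \<le> thompson K x y"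
    unfolding thompson_eq_Inf by (rule Inf_greatest) auto
qed

end

section \<open>Closedness of the cone: limits and attainment of the infimum\<close>

text \<open>Both bounds say that an expression jointly continuous in exponent and points lies in the
  closed set \<open>K\<close>. This is used once with a moving exponent and once with a moving
  point.\<close>

lemma exp_close_limit:
  fixes K :: "'a::real_tvs set"
  assumes "closed K" "F \<noteq> bot"
    and "(f \<longlongrightarrow> s) F" "(g \<longlongrightarrow> x) F" "(h \<longlongrightarrow> y) F"
    and "\<forall>\<^sub>F n in F. exp_close K (f n) (g n) (h n)"
  shows "exp_close K s x y"
  unfolding exp_close_def cone_le_def
proof
  have ev: "\<forall>\<^sub>F n in F. h n - exp (- f n) *\<^sub>R g n \<in> K" "\<forall>\<^sub>F n in F. exp (f n) *\<^sub>R g n - h n \<in> K"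
    using assms(6) by (auto simp: exp_close_def cone_le_def elim: eventually_mono)
  show "y - exp (- s) *\<^sub>R x \<in> K"
    using assms(1) ev(1) assms(2)
    by (rule Lim_in_closed_set) (intro tendsto_diff tendsto_scaleR_tvs tendsto_exp tendsto_minus assms)
  show "exp s *\<^sub>R x - y \<in> K"
    using assms(1) ev(2) assms(2)
    by (rule Lim_in_closed_set) (intro tendsto_diff tendsto_scaleR_tvs tendsto_exp tendsto_minus assms)
qed

text \<open>Linkedness makes the infimum finite, which matters because \<open>real_of_ereal\<close>
  sends \<infinity> to 0. Closedness makes the infimum attained.\<close>

lemma thompson_le_iff:
  fixes K :: "'a::real_tvs set"
  assumes cone: "ordering_cone K" and "closed K" and xy: "(x, y) \<in> linked K" and "0 \<le> s"
  shows "real_of_ereal (thompson K x y) \<le> s \<longleftrightarrow> exp_close K s x y"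
proof -
  obtain d where d: "thompson K x y = ereal d"
    using thompson_finite[OF cone xy] by (cases "thompson K x y") auto
  have K: "x \<in> K" "y \<in> K"
    using xy by (simp_all add: linked_def)
  show ?thesis
  proof
    assume "real_of_ereal (thompson K x y) \<le> s"
    then have "d \<le> s"
      using d by simp
    \<comment> \<open>Each bound strictly above the infimum exceeds some admissible exponent; the
      bounds then decrease to \<open>s\<close>.\<close>
    have "exp_close K (s + inverse (real (Suc n))) x y" for n
    proof -
      have "d < s + inverse (real (Suc n))"
        using \<open>d \<le> s\<close> by (smt (verit) inverse_positive_iff_positive of_nat_0_less_iff zero_less_Suc)
      then have "Inf (ereal ` {s. 0 \<le> s \<and> exp_close K s x y}) < ereal (s + inverse (real (Suc n)))"
        using d by (simp add: thompson_eq_Inf)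
      then obtain t where "exp_close K t x y" "t < s + inverse (real (Suc n))"
        by (auto simp: Inf_less_iff simp del: of_nat_Suc)
      then show ?thesis
        using exp_close_mono[OF cone K less_imp_le] by blast
    qed
    then show "exp_close K s x y"
      using LIMSEQ_inverse_real_of_nat_add[of s]
      by (intro exp_close_limit[OF \<open>closed K\<close> sequentially_bot _ tendsto_const tendsto_const]) auto
  next
    assume "exp_close K s x y"
    then have "thompson K x y \<le> ereal s"
      using \<open>0 \<le> s\<close> unfolding thompson_eq_Inf by (intro Inf_lower) auto
    then show "real_of_ereal (thompson K x y) \<le> s"
      using d by simp
  qed
qed

lemma thompson_Metric_space:
  fixes K :: "'a::real_tvs set"
  assumes cone: "ordering_cone K" and closed: "closed K"
    and C: "C \<times> C \<subseteq> linked K"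
  shows "Metric_space C (\<lambda>x y. real_of_ereal (thompson K x y))"
proof
  let ?d = "\<lambda>x y. real_of_ereal (thompson K x y)"
  show "?d x y = ?d y x" for x y
    using exp_close_sym[OF cone] by (simp add: thompson_eq_Inf)
  show nonneg: "0 \<le> ?d x y" for x y
    unfolding thompson_eq_Inf by (intro real_of_ereal_pos Inf_greatest) auto
  note le_iff = thompson_le_iff[OF cone closed]
  show "?d x y = 0 \<longleftrightarrow> x = y" if "x \<in> C" "y \<in> C" for x y
  proof -
    have "?d x y \<le> 0 \<longleftrightarrow> x = y"
      using le_iff[of x y 0] that C exp_close_0_iff[OF cone] by blast
    then show ?thesis
      using nonneg[of x y] by linarith
  qed
  show "?d x z \<le> ?d x y + ?d y z" if "x \<in> C" "y \<in> C" "z \<in> C" for x y z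
  proof -
    \<comment> \<open>By attainment the distances themselves are admissible exponents.\<close>
    have "exp_close K (?d x y) x y" "exp_close K (?d y z) y z"
      using le_iff that C nonneg by blast+
    then show ?thesis
      using le_iff[of x z] exp_close_trans[OF cone] that C nonneg by (meson SigmaI add_nonneg_nonneg subsetD)
  qed
qed

section \<open>Normality: from order estimates to the topology\<close>

lemma exp_close_Cauchy_imp_tvs_Cauchy:
  fixes K :: "'a::real_tvs set"
  assumes cone: "ordering_cone K" and normal: "normal_cone K" and K: "range u \<subseteq> K"
    and Cauchy: "\<And>e. e > 0 \<Longrightarrow> \<exists>N. \<forall>m\<ge>N. \<forall>n\<ge>N. exp_close K e (u m) (u n)"
  shows "tvs_Cauchy u"
  unfolding tvs_Cauchy_def
proof (intro allI impI, elim conjE)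
  fix U :: "'a set" assume "open U" "0 \<in> U"
  then obtain W V where W: "open W" "0 \<in> W" and V: "order_convex K V" and "W \<subseteq> V" "V \<subseteq> U"
    using normal unfolding normal_cone_def neighbourhood_base_at_def open_openin[symmetric] by meson
  \<comment> \<open>Tolerance 1 yields a bound \<open>b\<close> on the tail. It has to be fixed
    first, since \<open>e\<close> is chosen in terms of it.\<close>
  obtain N where N: "exp_close K 1 (u m) (u n)" if "m \<ge> N" "n \<ge> N" for m n
    using Cauchy[of 1] by auto
  define b where "b = exp 1 *\<^sub>R u N"
  have b: "cone_le K (u n) b" if "n \<ge> N" for n
    using N[of N n] that by (simp add: exp_close_def b_def)
  have lim: "((\<lambda>e. (exp e - 1) *\<^sub>R b) \<longlongrightarrow> 0) (at_right 0)"
    "((\<lambda>e. - ((exp e - 1) *\<^sub>R b)) \<longlongrightarrow> 0) (at_right 0)"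
  proof -
    have "((\<lambda>e::real. exp e - 1) \<longlongrightarrow> exp 0 - 1) (at_right 0)"
      by (intro tendsto_intros)
    then show 1: "((\<lambda>e. (exp e - 1) *\<^sub>R b) \<longlongrightarrow> 0) (at_right 0)"
      using tendsto_scaleR_tvs[OF _ tendsto_const] by fastforce
    show "((\<lambda>e. - ((exp e - 1) *\<^sub>R b)) \<longlongrightarrow> 0) (at_right 0)"
      using tendsto_minus[OF 1] by simp
  qed
  \<comment> \<open>For small \<open>e\<close> both endpoints of the order interval that will hold
    the differences lie in \<open>W\<close>, hence in the order-convex \<open>V\<close>.\<close>
  have "\<forall>\<^sub>F e in at_right (0::real). 0 < e \<and> (exp e - 1) *\<^sub>R b \<in> W \<and> - ((exp e - 1) *\<^sub>R b) \<in> W"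
    using lim[THEN topological_tendstoD, OF W] eventually_at_right_less by eventually_elim auto
  then obtain e where e: "e > 0" "(exp e - 1) *\<^sub>R b \<in> V" "- ((exp e - 1) *\<^sub>R b) \<in> V"
    using \<open>W \<subseteq> V\<close> eventually_happens' trivial_limit_at_right_real by (metis (no_types, lifting) subsetD)
  obtain M where M: "exp_close K e (u m) (u n)" if "m \<ge> M" "n \<ge> M" for m n
    using Cauchy[OF e(1)] by auto
  have diff_le: "cone_le K (u m - u n) ((exp e - 1) *\<^sub>R b)" if "m \<ge> max M N" "n \<ge> max M N" for m n
  proof (rule cone_le_trans[OF cone])
    show "cone_le K (u m - u n) ((exp e - 1) *\<^sub>R u n)"
      using M[of n m] that by (simp add: exp_close_def cone_le_def algebra_simps)
    show "cone_le K ((exp e - 1) *\<^sub>R u n) ((exp e - 1) *\<^sub>R b)"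
      using b[of n] that e(1) by (intro cone_le_scaleR[OF cone]) auto
  qed
  have "u m - u n \<in> U" if mn: "m \<ge> max M N" "n \<ge> max M N" for m n
  proof -
    \<comment> \<open>The upper estimate with \<open>m\<close> and \<open>n\<close> exchanged,
      negated.\<close>
    have "cone_le K (- ((exp e - 1) *\<^sub>R b)) (u m - u n)"
      using diff_le[OF mn(2,1)] by (simp add: cone_le_def algebra_simps)
    then have "u m - u n \<in> V"
      using V e(2,3) diff_le[OF mn] unfolding order_convex_def by blast
    then show ?thesis
      using \<open>V \<subseteq> U\<close> by blast
  qed
  then show "\<exists>N. \<forall>m\<ge>N. \<forall>n\<ge>N. u m - u n \<in> U"
    by blast
qed

section \<open>Components as complete metric spaces\<close>

theorem theorem4p17:
  fixes K C :: "'a::locally_convex_space set"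
  assumes "ordering_cone K"
    and "closed K"
    and "normal_cone K"
    and "sequentially_complete K"
    and "C \<in> components_of_cone K"
  shows "(\<forall>x\<in>C. \<forall>y\<in>C. thompson K x y \<noteq> \<infinity>) \<and>
    Metric_space C (\<lambda>x y. real_of_ereal (thompson K x y)) \<and>
    Metric_space.mcomplete C (\<lambda>x y. real_of_ereal (thompson K x y))"
proof (intro conjI ballI)
  let ?d = "\<lambda>x y. real_of_ereal (thompson K x y)"
  note equiv = equiv_linked[OF assms(1)]
  have C: "C \<in> K // linked K"
    using assms(5) by (simp add: components_of_cone_def)
  have linked: "(x, y) \<in> linked K" if "x \<in> C" "y \<in> C" for x y
    using quotient_eq_iff[OF equiv C C that] by blast
  have "C \<subseteq> K"
    using in_quotient_imp_subset[OF equiv C] .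
  show "thompson K x y \<noteq> \<infinity>" if "x \<in> C" "y \<in> C" for x y
    using thompson_finite(1)[OF assms(1) linked[OF that]] .
  show ms: "Metric_space C ?d"
    using linked by (intro thompson_Metric_space[OF assms(1,2)]) auto
  then interpret Metric_space C ?d .
  note le_iff = thompson_le_iff[OF assms(1,2) linked less_imp_le]
  show "Metric_space.mcomplete C ?d"
    unfolding mcomplete_def
  proof (intro allI impI)
    fix u assume "MCauchy u"
    then have u: "u n \<in> C" for n
      by (auto simp: MCauchy_def)
    have close: "\<exists>N. \<forall>m\<ge>N. \<forall>n\<ge>N. exp_close K e (u m) (u n)" if "e > 0" for e
      using \<open>MCauchy u\<close> that le_iff[OF u u that] unfolding MCauchy_def by (meson less_imp_le)
    have "range u \<subseteq> K"
      using u \<open>C \<subseteq> K\<close> by blast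
    moreover from this have "tvs_Cauchy u"
      using exp_close_Cauchy_imp_tvs_Cauchy[OF assms(1,3)] close by blast
    ultimately obtain x where x: "x \<in> K" "u \<longlonglongrightarrow> x"
      using assms(4) unfolding sequentially_complete_def by blast
    have close_x: "\<exists>N. \<forall>m\<ge>N. exp_close K e (u m) x" if e: "e > 0" for e
    proof -
      obtain N where N: "exp_close K e (u m) (u n)" if "m \<ge> N" "n \<ge> N" for m n
        using close[OF e] by blast
      \<comment> \<open>Here \<open>m\<close> stays fixed while the second index tends to
        infinity.\<close>
      have "exp_close K e (u m) x" if "m \<ge> N" for m
        by (rule exp_close_limit[OF assms(2) sequentially_bot tendsto_const tendsto_const x(2)])
          (use N that in \<open>auto simp: eventually_sequentially\<close>)
      then show ?thesis
        by blast
    qed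
    \<comment> \<open>A single term at finite distance from \<open>x\<close> places the limit in the
      component.\<close>
    then obtain m where "exp_close K 1 (u m) x"
      using zero_less_one by blast
    then have "(u m, x) \<in> linked K"
      using x(1) u \<open>C \<subseteq> K\<close> by (auto simp: linked_iff_exp_close[OF assms(1)] intro!: exI[of _ 1])
    then have "x \<in> C"
      using in_quotient_imp_closed[OF equiv C u] by blast
    have "\<exists>N. \<forall>n\<ge>N. u n \<in> C \<and> ?d (u n) x < e" if e: "e > 0" for e
    proof -
      \<comment> \<open>Halving \<open>e\<close> turns the weak inequality of \<open>le_iff\<close>
        into a strict one.\<close>
      obtain N where "exp_close K (e / 2) (u m) x" if "m \<ge> N" for m
        using close_x[of "e / 2"] e by auto
      then have "?d (u m) x < e" if "m \<ge> N" for m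
        using le_iff[OF u \<open>x \<in> C\<close>, of "e / 2" m] that e by fastforce
      then show ?thesis
        using u by blast
    qed
    then show "\<exists>x. limitin mtopology u x sequentially"
      using \<open>x \<in> C\<close> by (auto simp: limitin_metric eventually_sequentially)
  qed
qed

end
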